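(* Let $q^{n+1}$ be obtained from $q^n\in\mathbb Z^N$ by the conservative update $$q_i^{n+1}=q_i^n-\bigl(F(q_i^n,q_{i+1}^n)-F(q_{i-1}^n,q_i^n)\bigr)$$ on a periodic grid with $N$ cells. Then the total discrete mass is exactly conserved, $$\sum_{i=1}^Nq_i^{n+1}=\sum_{i=1}^Nq_i^n,$$ i.e. the sum over the closed domain of the discrete divergence (flux difference) $F(q_i^n,q_{i+1}^n)-F(q_{i-1}^n,q_i^n)$ vanishes. Moreover, any coarse observation that aggregates cells by summation observes the same invariant: for every partition of $\{1,\dots,N\}$ into blocks $B$, with $Q_B^n:=\sum_{i\in B}q_i^n$, one has $\sum_BQ_B^{n+1}=\sum_BQ_B^n=\sum_{i=1}^Nq_i^n$.
   Context: Indices are taken modulo $N$ (periodic grid). The interface count flux is $F(q_L,q_R)=\phi^+(q_L)+\phi^-(q_R)\in\mathbb Z$ for $q_L,q_R\in\mathbb Z$, where $\phi^\pm(q)=\mathrm{round}\bigl(f^\pm(\delta q)\frac{\Delta t}{\Delta x}\delta^{-1}\bigr)$, $\mathrm{round}$ is rounding to the nearest integer, $\delta,\Delta x,\Delta t>0$, and $f=f^++f^-$ is a splitting of the flux $f$ of a scalar conservation law with $(f^+)'\ge0$ and $(f^-)'\le0$. *)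

theory Defs
  imports Complex_Main "HOL-Library.Disjoint_Sets"
begin

definition flux_splitting :: "(real \<Rightarrow> real) \<Rightarrow> (real \<Rightarrow> real) \<Rightarrow> (real \<Rightarrow> real) \<Rightarrow> bool" where
  "flux_splitting f fp fm \<longleftrightarrow>
     (\<forall>u. f u = fp u + fm u) \<and>
     (\<forall>u. \<exists>D\<ge>0. (fp has_real_derivative D) (at u)) \<and>
     (\<forall>u. \<exists>D\<le>0. (fm has_real_derivative D) (at u))"

text \<open>The integer flux contribution of one part \<open>g\<close> of the splitting; \<open>round\<close> sends
  half-integers upwards.\<close>

definition count_flux :: "(real \<Rightarrow> real) \<Rightarrow> real \<Rightarrow> real \<Rightarrow> real \<Rightarrow> int \<Rightarrow> int" where
  "count_flux g \<delta> \<Delta>x \<Delta>t q = round (g (\<delta> * real_of_int q) * (\<Delta>t / \<Delta>x) * inverse \<delta>)"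

definition interface_flux ::
  "(real \<Rightarrow> real) \<Rightarrow> (real \<Rightarrow> real) \<Rightarrow> real \<Rightarrow> real \<Rightarrow> real \<Rightarrow> int \<Rightarrow> int \<Rightarrow> int" where
  "interface_flux fp fm \<delta> \<Delta>x \<Delta>t qL qR = count_flux fp \<delta> \<Delta>x \<Delta>t qL + count_flux fm \<delta> \<Delta>x \<Delta>t qR"

text \<open>A state in \<open>\<int>\<^sup>N\<close> is a function \<open>int \<Rightarrow> int\<close> of which only the values on \<open>{1..int N}\<close>
  are used. \<open>cell N i\<close> is the representative of \<open>i\<close> modulo \<open>N\<close> in \<open>{1..int N}\<close>.\<close>

definition cell :: "nat \<Rightarrow> int \<Rightarrow> int" where
  "cell N i = (i - 1) mod int N + 1"

definition flux_difference :: "nat \<Rightarrow> (int \<Rightarrow> int \<Rightarrow> int) \<Rightarrow> (int \<Rightarrow> int) \<Rightarrow> int \<Rightarrow> int" where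
  "flux_difference N F q i = F (q i) (q (cell N (i + 1))) - F (q (cell N (i - 1))) (q i)"

definition conservative_update ::
  "nat \<Rightarrow> (int \<Rightarrow> int \<Rightarrow> int) \<Rightarrow> (int \<Rightarrow> int) \<Rightarrow> (int \<Rightarrow> int) \<Rightarrow> bool" where
  "conservative_update N F q q' \<longleftrightarrow> (\<forall>i\<in>{1..int N}. q' i = q i - flux_difference N F q i)"

definition block_sum :: "(int \<Rightarrow> int) \<Rightarrow> int set \<Rightarrow> int" where
  "block_sum q B = (\<Sum>i\<in>B. q i)"

end

theory Submission
  imports Defs
begin

text \<open>The sum of flux differences telescopes around the ring: the flux through each interface
  leaves one cell and enters its right neighbour, so it occurs once with each sign. Formally, the
  left fluxes are the right fluxes shifted by one cell, and a cyclic shift does not change a sum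
  over all cells (\<open>sum_cell_shift\<close>). This gives \<open>sum_flux_difference\<close>,
  hence conservation of mass. Summing over the blocks of a partition only regroups the total
  (\<open>sum_block_sum\<close>), so it sees the same invariant.\<close>

lemma cell_in_range:
  assumes "N \<ge> 1"
  shows "cell N i \<in> {1..int N}"
  using assms by (simp add: cell_def add1_zle_eq)

lemma cell_eq_self:
  assumes "i \<in> {1..int N}"
  shows "cell N i = i"
  using assms by (simp add: cell_def)

text \<open>Taking representatives early is harmless, as for residues; hence successive shifts
  compose and opposite shifts cancel.\<close>

lemma cell_cell_add: "cell N (cell N i + k) = cell N (i + k)"
  by (simp add: cell_def algebra_simps mod_simps)

lemma cell_cell_diff: "cell N (cell N i - k) = cell N (i - k)"
  using cell_cell_add[of N i "- k"] by simp

text \<open>Translation by \<open>-k\<close> permutes the residues modulo \<open>N\<close>, with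
  translation by \<open>k\<close> as its inverse.\<close>

lemma sum_cell_shift:
  fixes g :: "int \<Rightarrow> 'a::comm_monoid_add"
  assumes "N \<ge> 1"
  shows "(\<Sum>i=1..int N. g (cell N (i - k))) = (\<Sum>i=1..int N. g i)"
  by (rule sum.reindex_bij_witness[where i = "\<lambda>i. cell N (i + k)" and j = "\<lambda>i. cell N (i - k)"])
    (use cell_in_range[OF assms] in \<open>simp_all add: cell_cell_add cell_cell_diff cell_eq_self\<close>)

lemma sum_flux_difference:
  assumes "N \<ge> 1"
  shows "(\<Sum>i=1..int N. flux_difference N F q i) = 0"
proof -
  \<comment> \<open>\<open>g i\<close> is the flux through the right interface of cell
    \<open>i\<close>. The left interface of \<open>i\<close> is the right one of its predecessor,
    also across the periodic boundary, because
    \<open>cell N (cell N (i - 1) + 1) = i\<close>.\<close>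
  define g where "g i = F (q i) (q (cell N (i + 1)))" for i
  have "flux_difference N F q i = g i - g (cell N (i - 1))" if "i \<in> {1..int N}" for i
    using that by (simp add: flux_difference_def g_def cell_cell_add cell_eq_self)
  then have "(\<Sum>i=1..int N. flux_difference N F q i) =
      (\<Sum>i=1..int N. g i) - (\<Sum>i=1..int N. g (cell N (i - 1)))"
    by (simp add: sum_subtractf)
  then show ?thesis
    by (simp add: sum_cell_shift[OF assms])
qed

lemma sum_conservative_update:
  assumes "N \<ge> 1" and "conservative_update N F q q'"
  shows "(\<Sum>i=1..int N. q' i) = (\<Sum>i=1..int N. q i)"
  using assms by (simp add: conservative_update_def sum_subtractf sum_flux_difference)

text \<open>The blocks are disjoint with union \<open>A\<close>, and finite as subsets of
  \<open>A\<close>, so the double sum meets each cell exactly once.\<close>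

lemma sum_block_sum:
  assumes "partition_on A P" and "finite A"
  shows "(\<Sum>B\<in>P. block_sum q B) = (\<Sum>i\<in>A. q i)"
proof -
  have "A = \<Union>P" and "\<forall>B\<in>P. finite B" and "\<forall>B\<in>P. \<forall>C\<in>P. B \<noteq> C \<longrightarrow> B \<inter> C = {}"
    using assms by (auto simp: partition_on_def disjoint_def intro: finite_subset)
  then show ?thesis
    by (simp add: sum.Union_disjoint block_sum_def)
qed

theorem lemma2p8:
  fixes N :: nat
    and f fp fm :: "real \<Rightarrow> real"
    and \<delta> \<Delta>x \<Delta>t :: real
    and q q' :: "int \<Rightarrow> int"
  assumes "N \<ge> 1"
    and "\<delta> > 0" and "\<Delta>x > 0" and "\<Delta>t > 0"
    and "flux_splitting f fp fm"
    and "conservative_update N (interface_flux fp fm \<delta> \<Delta>x \<Delta>t) q q'"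
  shows "(\<Sum>i=1..int N. q' i) = (\<Sum>i=1..int N. q i) \<and>
    (\<Sum>i=1..int N. flux_difference N (interface_flux fp fm \<delta> \<Delta>x \<Delta>t) q i) = 0 \<and>
    (\<forall>P. partition_on {1..int N} P \<longrightarrow>
       (\<Sum>B\<in>P. block_sum q' B) = (\<Sum>B\<in>P. block_sum q B) \<and>
       (\<Sum>B\<in>P. block_sum q B) = (\<Sum>i=1..int N. q i))"
  using sum_conservative_update[OF assms(1,6)] sum_flux_difference[OF assms(1)]
  by (simp add: sum_block_sum)

end
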